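(* Let $D$ be a subspace of an associative dialgebra over a field of characteristic not $2,3,5$ which is closed under the Jordan triple diproducts $(a,b,c)_1=\widehat{a}bc+cb\widehat{a}$ and $(a,b,c)_2=a\widehat{b}c+c\widehat{b}a$. Then $D$ is a Jordan triple disystem with respect to the operations $\{-,-,-\}_1=(-,-,-)_1$ and $\{-,-,-\}_2=(-,-,-)_2$.
   Context: An associative dialgebra is a vector space with two bilinear operations $\dashv,\vdash$ satisfying $(a\dashv b)\vdash c=(a\vdash b)\vdash c$, $a\dashv(b\dashv c)=a\dashv(b\vdash c)$, $(a\dashv b)\dashv c=a\dashv(b\dashv c)$, $(a\vdash b)\vdash c=a\vdash(b\vdash c)$, $(a\vdash b)\dashv c=a\vdash(b\dashv c)$. Hat notation: $a_1\cdots a_{i-1}\widehat{a}_i a_{i+1}\cdots a_n=(a_1\vdash\cdots\vdash a_{i-1})\vdash a_i\dashv(a_{i+1}\dashv\cdots\dashv a_n)$. Thus $(a,b,c)_1=(a\dashv b)\dashv c+c\vdash(b\vdash a)$ and $(a,b,c)_2=(a\vdash b)\dashv c+(c\vdash b)\dashv a$. A Jordan triple disystem is a vector space over a field of characteristic not $2$ with two trilinear operations $\{-,-,-\}_1,\{-,-,-\}_2$ satisfying, for all $a,b,c,d,e$: \begin{align*} &\{a,b,c\}_2 = \{c,b,a\}_2,\\ &\{ a, \{ b, c, d \}_1, e \}_1 = \{ a, \{ b, c, d \}_2, e \}_1,\\ &\{ a, b, \{ c, d, e \}_1 \}_1 = \{ a, b, \{ c, d, e \}_2 \}_1,\\ &\{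 \{ a, b, c \}_1, d, e \}_2 = \{ \{ a, b, c \}_2, d, e \}_2,\\ &\{ \{ e, d, c \}_1, b, a \}_1 = \{ \{ e, b, a \}_1, d, c \}_1 - \{ e, \{ d, a, b \}_1, c \}_1 + \{ e, d, \{ c, b, a \}_1 \}_1,\\ &\{ \{ e, d, c \}_2, b, a \}_1 = \{ \{ e, b, a \}_1, d, c \}_2 - \{ e, \{ d, a, b \}_1, c \}_2 + \{ e, d, \{ c, b, a \}_1 \}_2,\\ &\{ a, b, \{ c, d, e \}_1 \}_1 = \{ \{ a, b, c \}_1, d, e \}_1 - \{ c, \{ b, a, d \}_2, e \}_2 + \{ \{ a, b, e \}_1, d, c \}_1,\\ &\{ a, b, \{ c, d, e \}_1 \}_2 = \{ \{ a, b, c \}_2, d, e \}_1 - \{ c, \{ b, a, d \}_1, e \}_2 + \{ \{ a, b, e \}_2, d, c \}_1. \end{align*} *)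

theory Defs
  imports Complex_Main
begin

locale associative_dialgebra = vector_space scale
  for scale :: "'f::field \<Rightarrow> 'v::ab_group_add \<Rightarrow> 'v" (infixr \<open>*s\<close> 75) +
  fixes lprod :: "'v \<Rightarrow> 'v \<Rightarrow> 'v" (infixl \<open>\<stileturn>\<close> 70)
    and rprod :: "'v \<Rightarrow> 'v \<Rightarrow> 'v" (infixl \<open>\<turnstile>\<close> 70)
  assumes lprod_linear_left: "Vector_Spaces.linear scale scale (\<lambda>x. x \<stileturn> y)"
    and lprod_linear_right: "Vector_Spaces.linear scale scale (\<lambda>y. x \<stileturn> y)"
    and rprod_linear_left: "Vector_Spaces.linear scale scale (\<lambda>x. x \<turnstile> y)"
    and rprod_linear_right: "Vector_Spaces.linear scale scale (\<lambda>y. x \<turnstile> y)"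
    and left_bar: "(a \<stileturn> b) \<turnstile> c = (a \<turnstile> b) \<turnstile> c"
    and right_bar: "a \<stileturn> (b \<stileturn> c) = a \<stileturn> (b \<turnstile> c)"
    and left_assoc: "(a \<stileturn> b) \<stileturn> c = a \<stileturn> (b \<stileturn> c)"
    and right_assoc: "(a \<turnstile> b) \<turnstile> c = a \<turnstile> (b \<turnstile> c)"
    and inner_assoc: "(a \<turnstile> b) \<stileturn> c = a \<turnstile> (b \<stileturn> c)"

text \<open>In a hat product both operations point towards the marked factor:
  \<open>jordan_diproduct1\<close> marks \<open>a\<close> and \<open>jordan_diproduct2\<close> marks \<open>b\<close> in both words of \<open>abc + cba\<close>.\<close>

definition jordan_diproduct1 ::
    "('v \<Rightarrow> 'v \<Rightarrow> 'v) \<Rightarrow> ('v \<Rightarrow> 'v \<Rightarrow> 'v) \<Rightarrow> 'v \<Rightarrow> 'v \<Rightarrow> 'v \<Rightarrow> 'v::ab_group_add"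
  where "jordan_diproduct1 lprod rprod a b c = lprod (lprod a b) c + rprod c (rprod b a)"

definition jordan_diproduct2 ::
    "('v \<Rightarrow> 'v \<Rightarrow> 'v) \<Rightarrow> ('v \<Rightarrow> 'v \<Rightarrow> 'v) \<Rightarrow> 'v \<Rightarrow> 'v \<Rightarrow> 'v \<Rightarrow> 'v::ab_group_add"
  where "jordan_diproduct2 lprod rprod a b c = lprod (rprod a b) c + lprod (rprod c b) a"

definition linear_on ::
    "('f \<Rightarrow> 'v \<Rightarrow> 'v) \<Rightarrow> 'v set \<Rightarrow> ('v \<Rightarrow> 'v::ab_group_add) \<Rightarrow> bool"
  where "linear_on scale V f \<longleftrightarrow>
    (\<forall>x\<in>V. \<forall>y\<in>V. f (x + y) = f x + f y) \<and> (\<forall>r. \<forall>x\<in>V. f (scale r x) = scale r (f x))"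

definition trilinear_operation_on ::
    "('f \<Rightarrow> 'v \<Rightarrow> 'v) \<Rightarrow> 'v set \<Rightarrow> ('v \<Rightarrow> 'v \<Rightarrow> 'v \<Rightarrow> 'v::ab_group_add) \<Rightarrow> bool"
  where "trilinear_operation_on scale V t \<longleftrightarrow>
    (\<forall>a\<in>V. \<forall>b\<in>V. \<forall>c\<in>V. t a b c \<in> V) \<and>
    (\<forall>b\<in>V. \<forall>c\<in>V. linear_on scale V (\<lambda>a. t a b c)) \<and>
    (\<forall>a\<in>V. \<forall>c\<in>V. linear_on scale V (\<lambda>b. t a b c)) \<and>
    (\<forall>a\<in>V. \<forall>b\<in>V. linear_on scale V (\<lambda>c. t a b c))"

text \<open>The underlying vector space of a Jordan triple disystem is a set \<open>V\<close>, realised as a linear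
  subspace of the vector space on the type \<open>'v\<close> (possibly \<open>V = UNIV\<close>); the operations only matter
  on \<open>V\<close>.\<close>

locale jordan_triple_disystem = vector_space scale
  for scale :: "'f::field \<Rightarrow> 'v::ab_group_add \<Rightarrow> 'v" (infixr \<open>*s\<close> 75) +
  fixes V :: "'v set"
    and t1 :: "'v \<Rightarrow> 'v \<Rightarrow> 'v \<Rightarrow> 'v" (\<open>(\<open>notation=\<open>mixfix t1\<close>\<close>\<lbrace>_, _, _\<rbrace>\<^sub>1)\<close>)
    and t2 :: "'v \<Rightarrow> 'v \<Rightarrow> 'v \<Rightarrow> 'v" (\<open>(\<open>notation=\<open>mixfix t2\<close>\<close>\<lbrace>_, _, _\<rbrace>\<^sub>2)\<close>)
  assumes char_neq_2: "CHAR('f) \<noteq> 2"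
    and subspace_carrier: "subspace V"
    and t1_trilinear: "trilinear_operation_on scale V t1"
    and t2_trilinear: "trilinear_operation_on scale V t2"
    and t2_sym:
      "\<lbrakk>a \<in> V; b \<in> V; c \<in> V\<rbrakk> \<Longrightarrow> \<lbrace>a, b, c\<rbrace>\<^sub>2 = \<lbrace>c, b, a\<rbrace>\<^sub>2"
    and bar_middle:
      "\<lbrakk>a \<in> V; b \<in> V; c \<in> V; d \<in> V; e \<in> V\<rbrakk> \<Longrightarrow>
        \<lbrace>a, \<lbrace>b, c, d\<rbrace>\<^sub>1, e\<rbrace>\<^sub>1 = \<lbrace>a, \<lbrace>b, c, d\<rbrace>\<^sub>2, e\<rbrace>\<^sub>1"
    and bar_right:
      "\<lbrakk>a \<in> V; b \<in> V; c \<in> V; d \<in> V; e \<in> V\<rbrakk> \<Longrightarrow>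
        \<lbrace>a, b, \<lbrace>c, d, e\<rbrace>\<^sub>1\<rbrace>\<^sub>1 = \<lbrace>a, b, \<lbrace>c, d, e\<rbrace>\<^sub>2\<rbrace>\<^sub>1"
    and bar_left:
      "\<lbrakk>a \<in> V; b \<in> V; c \<in> V; d \<in> V; e \<in> V\<rbrakk> \<Longrightarrow>
        \<lbrace>\<lbrace>a, b, c\<rbrace>\<^sub>1, d, e\<rbrace>\<^sub>2 = \<lbrace>\<lbrace>a, b, c\<rbrace>\<^sub>2, d, e\<rbrace>\<^sub>2"
    and derivation_11:
      "\<lbrakk>a \<in> V; b \<in> V; c \<in> V; d \<in> V; e \<in> V\<rbrakk> \<Longrightarrow>
        \<lbrace>\<lbrace>e, d, c\<rbrace>\<^sub>1, b, a\<rbrace>\<^sub>1 =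
          \<lbrace>\<lbrace>e, b, a\<rbrace>\<^sub>1, d, c\<rbrace>\<^sub>1 - \<lbrace>e, \<lbrace>d, a, b\<rbrace>\<^sub>1, c\<rbrace>\<^sub>1 + \<lbrace>e, d, \<lbrace>c, b, a\<rbrace>\<^sub>1\<rbrace>\<^sub>1"
    and derivation_21:
      "\<lbrakk>a \<in> V; b \<in> V; c \<in> V; d \<in> V; e \<in> V\<rbrakk> \<Longrightarrow>
        \<lbrace>\<lbrace>e, d, c\<rbrace>\<^sub>2, b, a\<rbrace>\<^sub>1 =
          \<lbrace>\<lbrace>e, b, a\<rbrace>\<^sub>1, d, c\<rbrace>\<^sub>2 - \<lbrace>e, \<lbrace>d, a, b\<rbrace>\<^sub>1, c\<rbrace>\<^sub>2 + \<lbrace>e, d, \<lbrace>c, b, a\<rbrace>\<^sub>1\<rbrace>\<^sub>2"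
    and derivation_right_11:
      "\<lbrakk>a \<in> V; b \<in> V; c \<in> V; d \<in> V; e \<in> V\<rbrakk> \<Longrightarrow>
        \<lbrace>a, b, \<lbrace>c, d, e\<rbrace>\<^sub>1\<rbrace>\<^sub>1 =
          \<lbrace>\<lbrace>a, b, c\<rbrace>\<^sub>1, d, e\<rbrace>\<^sub>1 - \<lbrace>c, \<lbrace>b, a, d\<rbrace>\<^sub>2, e\<rbrace>\<^sub>2 + \<lbrace>\<lbrace>a, b, e\<rbrace>\<^sub>1, d, c\<rbrace>\<^sub>1"
    and derivation_right_12:
      "\<lbrakk>a \<in> V; b \<in> V; c \<in> V; d \<in> V; e \<in> V\<rbrakk> \<Longrightarrow>
        \<lbrace>a, b, \<lbrace>c, d, e\<rbrace>\<^sub>1\<rbrace>\<^sub>2 =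
          \<lbrace>\<lbrace>a, b, c\<rbrace>\<^sub>2, d, e\<rbrace>\<^sub>1 - \<lbrace>c, \<lbrace>b, a, d\<rbrace>\<^sub>1, e\<rbrace>\<^sub>2 + \<lbrace>\<lbrace>a, b, e\<rbrace>\<^sub>2, d, c\<rbrace>\<^sub>1"

end

theory Submission
  imports Defs
begin

text \<open>Erasing the indices from a defining identity of a Jordan triple disystem leaves an identity
  that \<open>{a, b, c} = abc + cba\<close> satisfies in every associative algebra: a trivial equality, the
  symmetry in the outer arguments, or the derivation identity. The indices are chosen so that,
  once the inner diproducts are expanded, all the words occurring in one identity carry the hat on
  the same variable.

  In a dialgebra a monomial is determined by its word of factors together with the factor that
  carries the hat (\<open>hat_normal_form\<close>). With the hat fixed throughout an identity, its two sides
  therefore agree as soon as the underlying words do, and these agree, with the same cancellations,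
  as in the associative case. The identities hold in the whole dialgebra and are inherited by every
  subspace closed under the two diproducts.\<close>

context associative_dialgebra
begin

lemmas product_module_hom =
  lprod_linear_left[THEN Vector_Spaces.linear.axioms(3)]
  lprod_linear_right[THEN Vector_Spaces.linear.axioms(3)]
  rprod_linear_left[THEN Vector_Spaces.linear.axioms(3)]
  rprod_linear_right[THEN Vector_Spaces.linear.axioms(3)]

lemmas product_additive = product_module_hom[THEN module_hom.add]

lemmas product_homogeneous = product_module_hom[THEN module_hom.scale]

text \<open>Oriented this way, the five axioms rewrite every bracketing to
  \<open>x\<^sub>1 \<turnstile> (\<dots> \<turnstile> (x\<^sub>i \<stileturn> (\<dots> \<stileturn> x\<^sub>n)))\<close>, the hat product with \<open>x\<^sub>i\<close> marked: associativity moves all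
  brackets to the right, and the bar laws turn the operations inside an argument that does not
  contain the marked factor towards that factor.\<close>

lemmas hat_normal_form =
  left_assoc right_assoc inner_assoc left_bar right_bar[symmetric]

abbreviation diproduct1 (\<open>\<lbrace>_, _, _\<rbrace>\<^sub>1\<close>)
  where "\<lbrace>a, b, c\<rbrace>\<^sub>1 \<equiv> jordan_diproduct1 (\<stileturn>) (\<turnstile>) a b c"

abbreviation diproduct2 (\<open>\<lbrace>_, _, _\<rbrace>\<^sub>2\<close>)
  where "\<lbrace>a, b, c\<rbrace>\<^sub>2 \<equiv> jordan_diproduct2 (\<stileturn>) (\<turnstile>) a b c"

lemmas diproduct_expand =
  jordan_diproduct1_def jordan_diproduct2_def product_additive hat_normal_form

lemma diproduct2_commute: "\<lbrace>a, b, c\<rbrace>\<^sub>2 = \<lbrace>c, b, a\<rbrace>\<^sub>2"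
  by (simp add: jordan_diproduct2_def add.commute)

text \<open>For the three bar identities, the nested diproduct occupies an unmarked argument of the
  outer one, where its own hat is lost; both indices then give the same two words.\<close>

lemma diproduct_bar_middle: "\<lbrace>a, \<lbrace>b, c, d\<rbrace>\<^sub>1, e\<rbrace>\<^sub>1 = \<lbrace>a, \<lbrace>b, c, d\<rbrace>\<^sub>2, e\<rbrace>\<^sub>1"
  by (simp add: diproduct_expand)

lemma diproduct_bar_right: "\<lbrace>a, b, \<lbrace>c, d, e\<rbrace>\<^sub>1\<rbrace>\<^sub>1 = \<lbrace>a, b, \<lbrace>c, d, e\<rbrace>\<^sub>2\<rbrace>\<^sub>1"
  by (simp add: diproduct_expand)

lemma diproduct_bar_left: "\<lbrace>\<lbrace>a, b, c\<rbrace>\<^sub>1, d, e\<rbrace>\<^sub>2 = \<lbrace>\<lbrace>a, b, c\<rbrace>\<^sub>2, d, e\<rbrace>\<^sub>2"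
  by (simp add: diproduct_expand)

text \<open>The next four are hat versions of the derivation identity
  \<open>{{e,d,c},b,a} = {{e,b,a},d,c} - {e,{d,a,b},c} + {e,d,{c,b,a}}\<close>, which states that
  \<open>x \<mapsto> {x,b,a} = xba + abx\<close> acts as a derivation on triple products, up to sign and a swap of
  \<open>a\<close> and \<open>b\<close> in the middle argument. The words \<open>edabc\<close> and \<open>ebadc\<close>, and their reversals, occur on
  the right with both signs. The first two identities mark a variable of the triple product that
  is acted upon (\<open>e\<close> and \<open>d\<close>).\<close>

lemma diproduct_derivation_11:
  "\<lbrace>\<lbrace>e, d, c\<rbrace>\<^sub>1, b, a\<rbrace>\<^sub>1 =
    \<lbrace>\<lbrace>e, b, a\<rbrace>\<^sub>1, d, c\<rbrace>\<^sub>1 - \<lbrace>e, \<lbrace>d, a, b\<rbrace>\<^sub>1, c\<rbrace>\<^sub>1 + \<lbrace>e, d, \<lbrace>c, b, a\<rbrace>\<^sub>1\<rbrace>\<^sub>1"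
  by (simp add: diproduct_expand algebra_simps)

lemma diproduct_derivation_21:
  "\<lbrace>\<lbrace>e, d, c\<rbrace>\<^sub>2, b, a\<rbrace>\<^sub>1 =
    \<lbrace>\<lbrace>e, b, a\<rbrace>\<^sub>1, d, c\<rbrace>\<^sub>2 - \<lbrace>e, \<lbrace>d, a, b\<rbrace>\<^sub>1, c\<rbrace>\<^sub>2 + \<lbrace>e, d, \<lbrace>c, b, a\<rbrace>\<^sub>1\<rbrace>\<^sub>2"
  by (simp add: diproduct_expand algebra_simps)

text \<open>Here the hat sits on a coefficient of the acting map \<open>x \<mapsto> {a,b,x}\<close> instead: on \<open>a\<close>, then on
  \<open>b\<close>. In the middle term \<open>a\<close> and \<open>b\<close> are swapped, so there the inner index is \<open>2\<close> for \<open>a\<close> and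
  \<open>1\<close> for \<open>b\<close>.\<close>

lemma diproduct_derivation_right_11:
  "\<lbrace>a, b, \<lbrace>c, d, e\<rbrace>\<^sub>1\<rbrace>\<^sub>1 =
    \<lbrace>\<lbrace>a, b, c\<rbrace>\<^sub>1, d, e\<rbrace>\<^sub>1 - \<lbrace>c, \<lbrace>b, a, d\<rbrace>\<^sub>2, e\<rbrace>\<^sub>2 + \<lbrace>\<lbrace>a, b, e\<rbrace>\<^sub>1, d, c\<rbrace>\<^sub>1"
  by (simp add: diproduct_expand algebra_simps)

lemma diproduct_derivation_right_12:
  "\<lbrace>a, b, \<lbrace>c, d, e\<rbrace>\<^sub>1\<rbrace>\<^sub>2 =
    \<lbrace>\<lbrace>a, b, c\<rbrace>\<^sub>2, d, e\<rbrace>\<^sub>1 - \<lbrace>c, \<lbrace>b, a, d\<rbrace>\<^sub>1, e\<rbrace>\<^sub>2 + \<lbrace>\<lbrace>a, b, e\<rbrace>\<^sub>2, d, c\<rbrace>\<^sub>1"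
  by (simp add: diproduct_expand algebra_simps)

lemma diproduct1_trilinear:
  assumes "\<And>a b c. \<lbrakk>a \<in> V; b \<in> V; c \<in> V\<rbrakk> \<Longrightarrow> \<lbrace>a, b, c\<rbrace>\<^sub>1 \<in> V"
  shows "trilinear_operation_on scale V (\<lambda>a b c. \<lbrace>a, b, c\<rbrace>\<^sub>1)"
  using assms unfolding trilinear_operation_on_def linear_on_def
  by (simp add: jordan_diproduct1_def product_additive product_homogeneous
      scale_right_distrib algebra_simps)

lemma diproduct2_trilinear:
  assumes "\<And>a b c. \<lbrakk>a \<in> V; b \<in> V; c \<in> V\<rbrakk> \<Longrightarrow> \<lbrace>a, b, c\<rbrace>\<^sub>2 \<in> V"
  shows "trilinear_operation_on scale V (\<lambda>a b c. \<lbrace>a, b, c\<rbrace>\<^sub>2)"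
  using assms unfolding trilinear_operation_on_def linear_on_def
  by (simp add: jordan_diproduct2_def product_additive product_homogeneous
      scale_right_distrib algebra_simps)

end

theorem theorem5p10:
  fixes scale :: "'f::field \<Rightarrow> 'v::ab_group_add \<Rightarrow> 'v"
    and lprod rprod :: "'v \<Rightarrow> 'v \<Rightarrow> 'v"
    and D :: "'v set"
  assumes "CHAR('f) \<notin> {2, 3, 5}"
    and "associative_dialgebra scale lprod rprod"
    and "module.subspace scale D"
    and "\<forall>a\<in>D. \<forall>b\<in>D. \<forall>c\<in>D. jordan_diproduct1 lprod rprod a b c \<in> D"
    and "\<forall>a\<in>D. \<forall>b\<in>D. \<forall>c\<in>D. jordan_diproduct2 lprod rprod a b c \<in> D"
  shows "jordan_triple_disystem scale D
    (jordan_diproduct1 lprod rprod) (jordan_diproduct2 lprod rprod)"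
proof -
  interpret associative_dialgebra scale lprod rprod by fact
  show ?thesis
  proof
    show "CHAR('f) \<noteq> 2" using assms(1) by simp
    show "subspace D" by fact
    show "trilinear_operation_on scale D (jordan_diproduct1 lprod rprod)"
      using diproduct1_trilinear assms(4) by blast
    show "trilinear_operation_on scale D (jordan_diproduct2 lprod rprod)"
      using diproduct2_trilinear assms(5) by blast
  qed (rule diproduct2_commute diproduct_bar_middle diproduct_bar_right diproduct_bar_left
      diproduct_derivation_11 diproduct_derivation_21
      diproduct_derivation_right_11 diproduct_derivation_right_12)+
qed

end
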